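(* Let $r>0$ be the riskless rate, $\sigma>0$ the stock volatility, $T>0$ a maturity, $K>0$ a strike, and let $\tau\in\mathbb{R}$, $D_\tau\ge0$, $A_\tau\ge0$, $B_\tau\ge0$ be constants. Put $V(\tau):=A_\tau\exp(-B_\tau\tau)$ and $K^{(\aleph_\tau)}:=D_\tau\tau$ (a real number, not to be confused with the strike $K$). Suppose the trader $\aleph_\tau$ has information about the stock-price mean return and volatility leading to the following risk-neutral stock-price dynamics, specific for $\aleph_\tau$: $$S_t^{(\aleph_\tau)}=\exp\Big(\big(r-D_\tau\tau-\tfrac12V(\tau)^2\sigma^2\big)t+V(\tau)\sigma B(t)\Big),\qquad t\ge0,$$ where $B$ is a standard Brownian motion. Then the value of $\aleph_\tau$'s short position in a European call contract with maturity price $C^{(\aleph_\tau)}(S_T^{(\aleph_\tau)},T)=\max(0,S_T^{(\aleph_\tau)}-K)$ is given, for $t\in[0,T]$, by $$C^{(\aleph_\tau)}\big(S_t^{(\aleph_\tau)},t\big)=e^{-K^{(\aleph_\tau)}(T-t)}S_t^{(\aleph_\tau)}N(d_1)-Ke^{-r(T-t)}N(d_2),$$ where $$d_1=\frac{\ln\big(S_t^{(\aleph_\tau)}/K\big)+\big(r-K^{(\aleph_\tau)}+\frac{\sigma^2}{2}V(\tau)^2\big)(T-t)}{\sigma V(\tau)\sqrt{T-t}},\qquad d_2=d_1-\sigma V(\tau)\sqrt{T-t}.$$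
   Context: $N$ denotes the cumulative distribution function of the standard normal law. $\aleph_\tau$ is a label for a trader with information parameter $\tau$ ($\tau>0$ informed, $\tau=0$ uninformed, $\tau<0$ misinformed). The trader's information is that the true stock price is a geometric Brownian motion with mean return $\mu$ and volatility $\sigma$, while the stock is traded as if it were a geometric Brownian motion with market-perceived mean return $\gamma>r>0$ and volatility $\varrho>0$. $D_\tau\tau$ plays the role of a dividend rate the trader enjoys owing to this information, and $V(\tau)$ is the parameter of informed volatility. The trader's value of a European contract is its value under the trader's risk-neutral dynamics, discounted at the riskless rate $r$. *)

theory Defs
  imports "HOL-Probability.Probability"
begin

locale standard_brownian_motion = prob_space M
  for M :: "'a measure" and W :: "real \<Rightarrow> 'a \<Rightarrow> real" +
  assumes measurable_W: "t \<ge> 0 \<Longrightarrow> W t \<in> borel_measurable M"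
    and start_zero: "AE \<omega> in M. W 0 \<omega> = 0"
    and normal_increments: "0 \<le> s \<Longrightarrow> s < t \<Longrightarrow>
      distributed M lborel (\<lambda>\<omega>. W t \<omega> - W s \<omega>) (normal_density 0 (sqrt (t - s)))"
    and indep_increments: "\<And>(n::nat) u. 0 \<le> u 0 \<Longrightarrow> strict_mono_on {..n} u \<Longrightarrow>
      indep_vars (\<lambda>_. borel) (\<lambda>i \<omega>. W (u (Suc i)) \<omega> - W (u i) \<omega>) {..<n}"
    and continuous_paths: "AE \<omega> in M. continuous_on {0..} (\<lambda>t. W t \<omega>)"

definition natural_filtration ::
  "'a measure \<Rightarrow> (real \<Rightarrow> 'a \<Rightarrow> real) \<Rightarrow> real \<Rightarrow> 'a measure" where
  "natural_filtration M W t =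
     sigma (space M) (\<Union>s\<in>{0..t}. {W s -` A \<inter> space M | A. A \<in> sets borel})"

text \<open>
  Value at time \<open>t\<close> of a contract paying \<open>X\<close> at maturity \<open>T\<close>. Here \<open>M\<close> is the risk-neutral
  law of the trader and \<open>F\<close> the flow of information. As a conditional expectation it is
  determined only up to a null set.
\<close>
definition risk_neutral_value ::
  "'a measure \<Rightarrow> (real \<Rightarrow> 'a measure) \<Rightarrow> real \<Rightarrow> real \<Rightarrow> ('a \<Rightarrow> real) \<Rightarrow> real \<Rightarrow> 'a \<Rightarrow> real" where
  "risk_neutral_value M F r T X t \<omega> = exp (- r * (T - t)) * real_cond_exp M (F t) X \<omega>"

text \<open>
  The standard normal distribution function takes an extended real argument because the
  quantities \<open>d\<^sub>1\<close>, \<open>d\<^sub>2\<close> of the Black--Scholes formula have denominator \<open>0\<close> at maturity and for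
  zero volatility. Division in \<^typ>\<open>ereal\<close> then yields the limiting value: \<open>x / 0\<close> is \<open>\<infinity>\<close> or
  \<open>-\<infinity>\<close> according to the sign of \<open>x\<close>. It yields \<open>0\<close> for \<open>x = 0\<close>, but then the two terms of the
  formula cancel whatever the value of \<open>d\<^sub>1 = d\<^sub>2\<close>.
\<close>
definition std_normal_cdf :: "ereal \<Rightarrow> real" where
  "std_normal_cdf x = measure std_normal_distribution {y. ereal y \<le> x}"

lemma std_normal_cdf_ereal [simp]: "std_normal_cdf (ereal x) = cdf std_normal_distribution x"
  by (simp add: std_normal_cdf_def cdf_def atMost_def)

lemma std_normal_cdf_PInf [simp]: "std_normal_cdf \<infinity> = 1"
  using prob_space.prob_space[OF prob_space_normal_density[of 1 0]]
  by (simp add: std_normal_cdf_def)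

lemma std_normal_cdf_MInf [simp]: "std_normal_cdf (- \<infinity>) = 0"
  by (simp add: std_normal_cdf_def)

end

theory Submission
  imports Defs
begin

text \<open>
  Given \<open>F\<^sub>t\<close>, the terminal price is \<open>S\<^sub>t\<close> times the exponential of a Gaussian increment that is
  independent of \<open>F\<^sub>t\<close>. Freezing the \<open>F\<^sub>t\<close>-measurable factor turns the conditional expectation of
  the payoff into a one-dimensional Gaussian integral, and completing the square evaluates it. At
  maturity, or for zero volatility, the payoff is itself \<open>F\<^sub>t\<close>-measurable.
\<close>

section \<open>Gaussian integrals\<close>

text \<open>Completing the square: the reflection z = v - w turns the tilted density into exp(v^2/2)
  times the standard normal density at w. It also turns the ray z \<ge> -d into w \<le> d + v, so a
  distribution function appears instead of an upper tail.\<close>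

lemma normal_exp_tail:
  fixes v d :: real
  shows "integrable std_normal_distribution (\<lambda>z. indicator {- d..} z * exp (v * z))"
    and "(\<integral>z. indicator {- d..} z * exp (v * z) \<partial>std_normal_distribution)
      = exp (v\<^sup>2 / 2) * cdf std_normal_distribution (d + v)"
proof -
  interpret real_distribution std_normal_distribution by (rule real_dist_normal_dist)
  let ?f = "\<lambda>z. std_normal_density z * (indicator {- d..} z * exp (v * z))"
  \<comment> \<open>The argument v - w is written \<open>v + - 1 * w\<close> to match the affine
    substitution t + c * w in \<open>lborel\<close>.\<close>
  have square: "?f (v + - 1 * w) = exp (v\<^sup>2 / 2) * (std_normal_density w * indicator {..d + v} w)" for w
  proof -
    have "- (v - w)\<^sup>2 / 2 + v * (v - w) = v\<^sup>2 / 2 + - w\<^sup>2 / 2"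
      by (simp add: power2_eq_square field_simps)
    then have "exp (- (v - w)\<^sup>2 / 2) * exp (v * (v - w)) = exp (v\<^sup>2 / 2) * exp (- w\<^sup>2 / 2)"
      by (metis exp_add)
    then have "std_normal_density (v - w) * exp (v * (v - w)) = exp (v\<^sup>2 / 2) * std_normal_density w"
      by (simp add: std_normal_density_def)
    then show ?thesis
      by (auto simp: indicator_def)
  qed
  have *: "integrable std_normal_distribution (indicator {..d + v} :: real \<Rightarrow> real)"
    by (intro integrable_real_indicator) (auto simp: emeasure_eq_measure)
  then have tail: "integrable lborel (\<lambda>w. std_normal_density w * indicator {..d + v} w :: real)"
    by (subst (asm) integrable_real_density) auto
  have "integrable lborel (\<lambda>w. ?f (v + - 1 * w))"
    unfolding square using tail by (rule integrable_mult_right)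
  then have "integrable lborel ?f"
    by (subst (asm) lborel_integrable_real_affine_iff) auto
  then show "integrable std_normal_distribution (\<lambda>z. indicator {- d..} z * exp (v * z))"
    by (subst integrable_real_density) auto
  have "(\<integral>z. indicator {- d..} z * exp (v * z) \<partial>std_normal_distribution) = (\<integral>z. ?f z \<partial>lborel)"
    by (subst integral_real_density) auto
  also have "\<dots> = (\<integral>w. exp (v\<^sup>2 / 2) * (std_normal_density w * indicator {..d + v} w) \<partial>lborel)"
    unfolding square[symmetric] by (subst lborel_integral_real_affine[where c = "- 1" and t = v]) auto
  also have "\<dots> = exp (v\<^sup>2 / 2) * (\<integral>w. indicator {..d + v} w \<partial>std_normal_distribution)"
    by (subst integral_real_density) auto
  also have "(\<integral>w. indicator {..d + v} w \<partial>std_normal_distribution)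
      = cdf std_normal_distribution (d + v)"
    by (simp add: cdf_def)
  finally show "(\<integral>z. indicator {- d..} z * exp (v * z) \<partial>std_normal_distribution)
      = exp (v\<^sup>2 / 2) * cdf std_normal_distribution (d + v)" .
qed

text \<open>Exponential tilting by v only shifts the mean of the normal density to v, up to the
  factor exp(v^2/2).\<close>

lemma integrable_normal_exp: "integrable std_normal_distribution (\<lambda>z. exp (v * z))"
proof -
  have "std_normal_density z * exp (v * z) = exp (v\<^sup>2 / 2) * normal_density v 1 z" for z
  proof -
    have "- z\<^sup>2 / 2 + v * z = v\<^sup>2 / 2 + - (z - v)\<^sup>2 / 2"
      by (simp add: power2_eq_square field_simps)
    then have "exp (- z\<^sup>2 / 2) * exp (v * z) = exp (v\<^sup>2 / 2) * exp (- (z - v)\<^sup>2 / 2)"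
      by (metis exp_add)
    then show ?thesis
      by (simp add: normal_density_def)
  qed
  then have "integrable lborel (\<lambda>z. std_normal_density z * exp (v * z))"
    by simp
  then show ?thesis
    by (subst integrable_real_density) auto
qed

text \<open>The option is exercised exactly when z \<ge> -d, so the payoff is a difference of two
  truncated exponentials, each evaluated by \<open>normal_exp_tail\<close>.\<close>

lemma black_scholes_integral:
  fixes x K c v :: real
  assumes "x > 0" "K > 0" "v > 0"
  defines "d \<equiv> (ln (x / K) + c) / v"
  shows "(\<integral>z. max 0 (x * exp (c + v * z) - K) \<partial>std_normal_distribution)
    = x * exp (c + v\<^sup>2 / 2) * cdf std_normal_distribution (d + v) - K * cdf std_normal_distribution d"
proof -
  \<comment> \<open>The factor \<open>exp (0 * z)\<close> makes the strike term the instance v = 0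
    of \<open>normal_exp_tail\<close>.\<close>
  have "max 0 (x * exp (c + v * z) - K)
      = x * exp c * (indicator {- d..} z * exp (v * z)) - K * (indicator {- d..} z * exp (0 * z))" for z
  proof -
    have "K \<le> x * exp (c + v * z) \<longleftrightarrow> ln K \<le> ln (x * exp (c + v * z))"
      using assms by (subst ln_le_cancel_iff) auto
    also have "\<dots> \<longleftrightarrow> - d \<le> z"
      using assms by (simp add: d_def ln_mult ln_div field_simps)
    finally show ?thesis
      by (auto simp: indicator_def exp_add max_def)
  qed
  then have "(\<integral>z. max 0 (x * exp (c + v * z) - K) \<partial>std_normal_distribution)
      = x * exp c * (\<integral>z. indicator {- d..} z * exp (v * z) \<partial>std_normal_distribution)
        - K * (\<integral>z. indicator {- d..} z * exp (0 * z) \<partial>std_normal_distribution)"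
    by (simp only: Bochner_Integration.integral_diff integrable_mult_right normal_exp_tail(1)
        integral_mult_right_zero)
  then show ?thesis
    unfolding normal_exp_tail(2) by (simp add: exp_add mult.assoc)
qed

section \<open>Conditioning on an independent \<open>\<sigma>\<close>-algebra\<close>

context prob_space
begin

text \<open>By independence, the pair of the sample point, seen through \<open>F\<close>, and
  \<open>Y\<close> has a product law. Fubini then integrates out \<open>Y\<close> with the sample
  point held fixed, and testing against sets of \<open>F\<close> identifies the result as the
  conditional expectation.\<close>

lemma real_cond_exp_freeze:
  fixes g :: "'a \<Rightarrow> 'b \<Rightarrow> real"
  assumes F: "subalgebra M F"
    and Y: "random_variable L Y"
    and indep: "indep_set (sets F) {Y -` A \<inter> space M | A. A \<in> sets L}"
    and g: "case_prod g \<in> borel_measurable (F \<Otimes>\<^sub>M L)"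
    and int: "integrable M (\<lambda>\<omega>. g \<omega> (Y \<omega>))"
  shows "AE \<omega> in M. real_cond_exp M F (\<lambda>\<omega>. g \<omega> (Y \<omega>)) \<omega> = expectation (\<lambda>\<omega>'. g \<omega> (Y \<omega>'))"
proof -
  interpret finite_measure_subalgebra M F
    by unfold_locales (rule F)
  have space_F: "space F = space M" and sets_F: "sets F \<subseteq> events"
    using F by (auto simp: subalgebra_def)
  have id: "(\<lambda>\<omega>. \<omega>) \<in> measurable M F"
    using sets_F by (auto simp: measurable_def space_F dest: sets.sets_into_space)
  \<comment> \<open>\<open>P\<close> is the restriction of \<open>M\<close> to \<open>F\<close>,
    realised as the image under the identity map.\<close>
  define P where "P = distr M F (\<lambda>\<omega>. \<omega>)"
  define Q where "Q = distr M L Y"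
  interpret P: prob_space P unfolding P_def by (rule prob_space_distr) (rule id)
  interpret Q: prob_space Q unfolding Q_def by (rule prob_space_distr) (rule Y)
  interpret PQ: pair_prob_space P Q ..
  have pair: "(\<lambda>\<omega>. (\<omega>, Y \<omega>)) \<in> measurable M (F \<Otimes>\<^sub>M L)"
    by (intro measurable_Pair id Y)
  have joint: "P \<Otimes>\<^sub>M Q = distr M (F \<Otimes>\<^sub>M L) (\<lambda>\<omega>. (\<omega>, Y \<omega>))"
  proof (rule pair_measure_eqI)
    fix A B assume "A \<in> sets P" "B \<in> sets Q"
    then have A: "A \<in> sets F" "A \<in> events" "A \<subseteq> space M" and B: "B \<in> sets L"
      using sets_F sets.sets_into_space by (auto simp: P_def Q_def)
    have "(\<lambda>\<omega>. (\<omega>, Y \<omega>)) -` (A \<times> B) \<inter> space M = A \<inter> (Y -` B \<inter> space M)"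
      using A by auto
    then have "measure (distr M (F \<Otimes>\<^sub>M L) (\<lambda>\<omega>. (\<omega>, Y \<omega>))) (A \<times> B) = prob (A \<inter> (Y -` B \<inter> space M))"
      using A B by (simp add: measure_distr[OF pair])
    also have "\<dots> = prob A * prob (Y -` B \<inter> space M)"
      using indep A B by (intro indep_setD) auto
    also have "\<dots> = measure P A * measure Q B"
      using A B by (simp add: P_def Q_def measure_distr[OF id] measure_distr[OF Y] Int_absorb2)
    finally show "emeasure P A * emeasure Q B = emeasure (distr M (F \<Otimes>\<^sub>M L) (\<lambda>\<omega>. (\<omega>, Y \<omega>))) (A \<times> B)"
      using finite_measure.emeasure_eq_measure[OF prob_space.finite_measure[OF prob_space_distr[OF pair]]]
      by (simp add: P.emeasure_eq_measure Q.emeasure_eq_measure ennreal_mult)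
  next
    show "sets (P \<Otimes>\<^sub>M Q) = sets (distr M (F \<Otimes>\<^sub>M L) (\<lambda>\<omega>. (\<omega>, Y \<omega>)))"
      by (simp add: P_def Q_def cong: sets_pair_measure_cong)
  qed (rule P.sigma_finite_measure_axioms Q.sigma_finite_measure_axioms)+
  \<comment> \<open>Stated for general \<open>f\<close> because it serves twice: for
    \<open>g\<close> itself (integrability) and for \<open>g\<close> times the indicator of a set of
    \<open>F\<close> (the test identity).\<close>
  have fubini: "integrable M (\<lambda>\<omega>. \<integral>y. f \<omega> y \<partial>Q)"
      "(\<integral>\<omega>. f \<omega> (Y \<omega>) \<partial>M) = (\<integral>\<omega>. (\<integral>y. f \<omega> y \<partial>Q) \<partial>M)"
    if f: "case_prod f \<in> borel_measurable (F \<Otimes>\<^sub>M L)" and int: "integrable M (\<lambda>\<omega>. f \<omega> (Y \<omega>))"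
    for f :: "'a \<Rightarrow> 'b \<Rightarrow> real"
  proof -
    have int': "integrable (P \<Otimes>\<^sub>M Q) (case_prod f)"
      unfolding joint using int by (subst integrable_distr_eq[OF pair f]) simp
    have meas: "(\<lambda>\<omega>. \<integral>y. f \<omega> y \<partial>Q) \<in> borel_measurable F"
      using borel_measurable_integrable[OF PQ.integrable_fst'[OF int']] by (simp add: P_def)
    show "integrable M (\<lambda>\<omega>. \<integral>y. f \<omega> y \<partial>Q)"
      using PQ.integrable_fst'[OF int'] unfolding P_def by (simp add: integrable_distr_eq[OF id meas])
    have "(\<integral>\<omega>. f \<omega> (Y \<omega>) \<partial>M) = (\<integral>p. case_prod f p \<partial>(P \<Otimes>\<^sub>M Q))"
      unfolding joint by (subst integral_distr[OF pair f]) simp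
    also have "\<dots> = (\<integral>\<omega>. (\<integral>y. f \<omega> y \<partial>Q) \<partial>P)"
      using PQ.integral_fst'[OF int'] by simp
    also have "\<dots> = (\<integral>\<omega>. (\<integral>y. f \<omega> y \<partial>Q) \<partial>M)"
      unfolding P_def by (rule integral_distr[OF id meas])
    finally show "(\<integral>\<omega>. f \<omega> (Y \<omega>) \<partial>M) = (\<integral>\<omega>. (\<integral>y. f \<omega> y \<partial>Q) \<partial>M)" .
  qed
  have "AE \<omega> in M. real_cond_exp M F (\<lambda>\<omega>. g \<omega> (Y \<omega>)) \<omega> = (\<integral>y. g \<omega> y \<partial>Q)"
  proof (rule real_cond_exp_charact)
    fix A assume A: "A \<in> sets F"
    have "case_prod (\<lambda>\<omega> y. indicator A \<omega> * g \<omega> y) \<in> borel_measurable (F \<Otimes>\<^sub>M L)"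
      using g A by measurable
    moreover have "integrable M (\<lambda>\<omega>. indicator A \<omega> * g \<omega> (Y \<omega>))"
      using integrable_mult_indicator[OF _ int] A sets_F by auto
    ultimately show "(\<integral>\<omega>\<in>A. g \<omega> (Y \<omega>) \<partial>M) = (\<integral>\<omega>\<in>A. (\<integral>y. g \<omega> y \<partial>Q) \<partial>M)"
      using fubini(2)[of "\<lambda>\<omega> y. indicator A \<omega> * g \<omega> y"]
      by (simp add: set_lebesgue_integral_def)
  next
    have "case_prod g \<in> borel_measurable (F \<Otimes>\<^sub>M Q)"
      using g by (simp add: Q_def cong: measurable_cong_sets)
    then show "(\<lambda>\<omega>. \<integral>y. g \<omega> y \<partial>Q) \<in> borel_measurable F"
      by (rule Q.borel_measurable_lebesgue_integral)
  qed (use int fubini(1)[OF g int] in auto)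
  moreover have "(\<integral>y. g \<omega> y \<partial>Q) = expectation (\<lambda>\<omega>'. g \<omega> (Y \<omega>'))" if "\<omega> \<in> space M" for \<omega>
    unfolding Q_def
    by (rule integral_distr[OF Y]) (use measurable_Pair2[OF g] that space_F in simp)
  ultimately show ?thesis
    by (auto intro: AE_mp)
qed

end

section \<open>Brownian increments and the past\<close>

context standard_brownian_motion
begin

lemma space_natural_filtration [simp]: "space (natural_filtration M W t) = space M"
  unfolding natural_filtration_def by (rule space_measure_of) auto

lemma sets_natural_filtration:
  "sets (natural_filtration M W t) =
    sigma_sets (space M) (\<Union>s\<in>{0..t}. {W s -` A \<inter> space M | A. A \<in> sets borel})"
  unfolding natural_filtration_def by (rule sets_measure_of) auto

lemma subalgebra_natural_filtration: "subalgebra M (natural_filtration M W t)"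
  unfolding subalgebra_def sets_natural_filtration
  using measurable_W by (auto intro!: sets.sigma_sets_subset simp: measurable_sets)

lemma measurable_natural_filtration:
  assumes "0 \<le> s" "s \<le> t"
  shows "W s \<in> borel_measurable (natural_filtration M W t)"
proof (rule measurableI)
  fix A :: "real set" assume "A \<in> sets borel"
  then have "W s -` A \<inter> space M \<in> (\<Union>s\<in>{0..t}. {W s -` A \<inter> space M | A. A \<in> sets borel})"
    using assms by fastforce
  then show "W s -` A \<inter> space (natural_filtration M W t) \<in> sets (natural_filtration M W t)"
    by (simp add: sets_natural_filtration sigma_sets.Basic)
qed simp

lemma indep_past_cylinder:
  assumes t: "0 \<le> t" "t < T"
    and J: "finite J" "J \<subseteq> {0..t}" and A: "\<And>s. A s \<in> sets borel" and B: "B \<in> sets borel"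
  defines "C \<equiv> {\<omega> \<in> space M. \<forall>s\<in>J. W s \<omega> \<in> A s}"
    and "D \<equiv> (\<lambda>\<omega>. W T \<omega> - W t \<omega>) -` B \<inter> space M"
  shows "prob (C \<inter> D) = prob C * prob D"
proof -
  (* Only increments are known to be independent, so C is replaced by the almost surely equal event
     C' expressed through the increments between consecutive times of J together with 0 and t. *)
  define xs where "xs = sorted_list_of_set (insert 0 (insert t J))"
  define m where "m = length xs - 1"
  have set_xs: "set xs = insert 0 (insert t J)"
    using J by (simp add: xs_def del: sorted_list_of_set_insert_remove)
  have strict: "xs ! i < xs ! j" if "i < j" "j < length xs" for i j
    using that strict_sorted_list_of_set[of "insert 0 (insert t J)"]
    by (simp add: xs_def sorted_wrt_iff_nth_less)
  have "xs \<noteq> []"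
    using set_xs by auto
  then have len: "length xs = Suc m"
    by (simp add: m_def)
  have range: "0 \<le> xs ! i \<and> xs ! i \<le> t" if "i \<le> m" for i
    using that set_xs nth_mem[of i xs] J t len by auto
  have first: "xs ! 0 = 0"
  proof -
    obtain i where "i \<le> m" "xs ! i = 0"
      using set_xs len by (metis in_set_conv_nth insertI1 less_Suc_eq_le)
    then show ?thesis
      using strict[of 0 i] range[of 0] len by (cases "i = 0") auto
  qed
  have last: "xs ! m = t"
  proof -
    obtain i where "i \<le> m" "xs ! i = t"
      using set_xs len by (metis in_set_conv_nth insertI1 insertI2 less_Suc_eq_le)
    then show ?thesis
      using strict[of i m] range[of m] len by (cases "i = m") auto
  qed
  \<comment> \<open>Index \<open>Suc m\<close> carries \<open>T\<close>, so increment number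
    \<open>m\<close> is the one in \<open>D\<close>. From there on \<open>u\<close> is constant, so
    strict monotonicity is claimed only up to \<open>Suc m\<close>.\<close>
  define u where "u i = (if i \<le> m then xs ! i else T)" for i
  have "strict_mono_on {..Suc m} u"
  proof (rule strict_mono_onI)
    fix i j assume "i \<in> {..Suc m}" "j \<in> {..Suc m}" "i < j"
    then show "u i < u j"
      using strict[of i j] range[of i] t len by (auto simp: u_def)
  qed
  then have "indep_vars (\<lambda>_. borel) (\<lambda>i \<omega>. W (u (Suc i)) \<omega> - W (u i) \<omega>) {..<Suc m}"
    using indep_increments[of u "Suc m"] first by (simp add: u_def)
  \<comment> \<open>Grouping the independent increments into the blocks \<open>{..<m}\<close> and
    \<open>{m}\<close> separates the past from the future.\<close>
  then have indep: "indep_var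
      (PiM {..<m} (\<lambda>_. borel)) (\<lambda>\<omega>. \<lambda>i\<in>{..<m}. W (u (Suc i)) \<omega> - W (u i) \<omega>)
      (PiM {m} (\<lambda>_. borel)) (\<lambda>\<omega>. \<lambda>i\<in>{m}. W (u (Suc i)) \<omega> - W (u i) \<omega>)"
    by (rule indep_var_restrict) auto
  have "\<forall>s\<in>J. \<exists>i\<le>m. s = u i"
    using set_xs len unfolding u_def by (metis in_set_conv_nth insertI2 less_Suc_eq_le)
  then obtain k where k: "\<And>s. s \<in> J \<Longrightarrow> k s \<le> m" "\<And>s. s \<in> J \<Longrightarrow> u (k s) = s"
    by metis
  \<comment> \<open>Since s is the grid point number \<open>k s\<close>, the first
    \<open>k s\<close> increments add up to W s - W 0; \<open>E\<close> is the cylinder condition on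
    these sums.\<close>
  define E where "E = {f \<in> space (PiM {..<m} (\<lambda>_. borel)). \<forall>s\<in>J. (\<Sum>i<k s. f i :: real) \<in> A s}"
  define G where "G = {f \<in> space (PiM {m} (\<lambda>_. borel)). f m \<in> B}"
  have E: "E \<in> sets (PiM {..<m} (\<lambda>_. borel))"
  proof -
    have "(\<lambda>f. \<Sum>i<k s. f i) \<in> borel_measurable (PiM {..<m} (\<lambda>_. borel :: real measure))" if "s \<in> J" for s
      using k(1)[OF that] by (intro borel_measurable_sum measurable_component_singleton) auto
    then show ?thesis
      unfolding E_def using J(1) A
      by (intro sets.sets_Collect_finite_All) (auto intro: measurable_sets_borel simp: pred_def)
  qed
  have G: "G \<in> sets (PiM {m} (\<lambda>_. borel))"
    unfolding G_def using B by measurable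
  define C' where "C' = (\<lambda>\<omega>. \<lambda>i\<in>{..<m}. W (u (Suc i)) \<omega> - W (u i) \<omega>) -` E \<inter> space M"
  have C': "C' \<in> events"
    unfolding C'_def by (rule measurable_sets[OF indep_var_rv1[OF indep] E])
  have D: "D = (\<lambda>\<omega>. \<lambda>i\<in>{m}. W (u (Suc i)) \<omega> - W (u i) \<omega>) -` G \<inter> space M"
    by (auto simp: D_def G_def u_def last space_PiM)
  have prod: "prob (C' \<inter> D) = prob C' * prob D"
  proof -
    have "C' \<inter> D = (\<lambda>\<omega>. (\<lambda>i\<in>{..<m}. W (u (Suc i)) \<omega> - W (u i) \<omega>,
        \<lambda>i\<in>{m}. W (u (Suc i)) \<omega> - W (u i) \<omega>)) -` (E \<times> G) \<inter> space M"
      unfolding C'_def D by blast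
    then show ?thesis
      using indep_varD[OF indep E G] unfolding C'_def D by simp
  qed
  have D_meas: "D \<in> events"
    unfolding D by (rule measurable_sets[OF indep_var_rv2[OF indep] G])
  have C: "C \<in> events"
    unfolding C_def using J A measurable_W
    by (intro sets.sets_Collect_finite_All) (auto simp: subset_iff)
  \<comment> \<open>By telescoping, \<open>C\<close> and \<open>C'\<close> can differ only where
    \<open>W 0\<close> is nonzero, a null set.\<close>
  have eq: "AE \<omega> in M. \<omega> \<in> C \<longleftrightarrow> \<omega> \<in> C'"
    using start_zero
  proof (rule AE_mp, intro AE_I2 impI)
    fix \<omega> assume \<omega>: "\<omega> \<in> space M" "W 0 \<omega> = 0"
    have "(\<Sum>i<k s. (\<lambda>i\<in>{..<m}. W (u (Suc i)) \<omega> - W (u i) \<omega>) i) = W s \<omega>" if "s \<in> J" for s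
    proof -
      have "(\<Sum>i<k s. (\<lambda>i\<in>{..<m}. W (u (Suc i)) \<omega> - W (u i) \<omega>) i)
          = (\<Sum>i<k s. W (u (Suc i)) \<omega> - W (u i) \<omega>)"
        using k(1)[OF that] by (intro sum.cong) auto
      also have "\<dots> = W (u (k s)) \<omega> - W (u 0) \<omega>"
        by (rule sum_lessThan_telescope)
      finally show ?thesis
        using k(2)[OF that] \<omega> first by (simp add: u_def)
    qed
    then show "\<omega> \<in> C \<longleftrightarrow> \<omega> \<in> C'"
      using \<omega> by (simp add: C_def C'_def E_def space_PiM)
  qed
  have "prob C = prob C'"
    using eq C C' by (intro finite_measure_eq_AE) auto
  moreover have "prob (C \<inter> D) = prob (C' \<inter> D)"
    using eq C C' D_meas by (intro finite_measure_eq_AE) auto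
  ultimately show ?thesis
    using prod by simp
qed

text \<open>Cylinder events over finitely many times form an intersection-stable generator of the
  past. The product formula for them therefore extends to the generated \<sigma>-algebra.\<close>

lemma indep_past_increment:
  assumes t: "0 \<le> t" "t < T"
  shows "indep_set (sets (natural_filtration M W t))
    {(\<lambda>\<omega>. W T \<omega> - W t \<omega>) -` B \<inter> space M | B. B \<in> sets borel}"
proof -
  define \<C> where "\<C> = {{\<omega> \<in> space M. \<forall>s\<in>J. W s \<omega> \<in> A s} | J A.
    finite J \<and> J \<subseteq> {0..t} \<and> (\<forall>s. A s \<in> sets borel)}"
  define \<D> where "\<D> = {(\<lambda>\<omega>. W T \<omega> - W t \<omega>) -` B \<inter> space M | B. B \<in> sets borel}"
  have \<D>_events: "\<D> \<subseteq> events"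
  proof -
    have "random_variable borel (\<lambda>\<omega>. W T \<omega> - W t \<omega>)"
      using t by (intro borel_measurable_diff measurable_W) auto
    then show ?thesis
      by (auto simp: \<D>_def)
  qed
  have "indep_set \<C> \<D>"
  proof (rule indep_setI)
    show "\<C> \<subseteq> events"
      unfolding \<C>_def using measurable_W
      by (auto intro!: sets.sets_Collect_finite_All simp: subset_iff)
    show "prob (a \<inter> b) = prob a * prob b" if "a \<in> \<C>" "b \<in> \<D>" for a b
      using that t indep_past_cylinder unfolding \<C>_def \<D>_def by blast
  qed (rule \<D>_events)
  moreover have "Int_stable \<C>"
  proof (rule Int_stableI)
    fix a b assume "a \<in> \<C>" "b \<in> \<C>"
    then obtain J A J' A' where
      a: "a = {\<omega> \<in> space M. \<forall>s\<in>J. W s \<omega> \<in> A s}" "finite J" "J \<subseteq> {0..t}" "\<And>s. A s \<in> sets borel" and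
      b: "b = {\<omega> \<in> space M. \<forall>s\<in>J'. W s \<omega> \<in> A' s}" "finite J'" "J' \<subseteq> {0..t}" "\<And>s. A' s \<in> sets borel"
      unfolding \<C>_def by blast
    \<comment> \<open>A time belonging to only one of the two index sets is unconstrained by the
      other event, hence \<open>UNIV\<close>.\<close>
    let ?A = "\<lambda>s. (if s \<in> J then A s else UNIV) \<inter> (if s \<in> J' then A' s else UNIV)"
    have "a \<inter> b = {\<omega> \<in> space M. \<forall>s\<in>J \<union> J'. W s \<omega> \<in> ?A s}"
      unfolding a(1) b(1) by (auto split: if_splits)
    moreover have "finite (J \<union> J')" "J \<union> J' \<subseteq> {0..t}" "\<forall>s. ?A s \<in> sets borel"
      using a b by auto
    ultimately show "a \<inter> b \<in> \<C>"
      unfolding \<C>_def by (intro CollectI exI[of _ "J \<union> J'"] exI[of _ ?A] conjI)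
  qed
  moreover have "Int_stable \<D>"
  proof (rule Int_stableI)
    fix a b assume "a \<in> \<D>" "b \<in> \<D>"
    then obtain B B' where "B \<in> sets borel" "B' \<in> sets borel"
      "a = (\<lambda>\<omega>. W T \<omega> - W t \<omega>) -` B \<inter> space M" "b = (\<lambda>\<omega>. W T \<omega> - W t \<omega>) -` B' \<inter> space M"
      unfolding \<D>_def by blast
    then show "a \<inter> b \<in> \<D>"
      unfolding \<D>_def by (intro CollectI exI[of _ "B \<inter> B'"]) auto
  qed
  ultimately have indep: "indep_set (sigma_sets (space M) \<C>) (sigma_sets (space M) \<D>)"
    by (rule indep_set_sigma_sets)
  have "W s -` A \<inter> space M \<in> \<C>" if "s \<in> {0..t}" "A \<in> sets borel" for s A
    unfolding \<C>_def using that by (intro CollectI exI[of _ "{s}"] exI[of _ "\<lambda>_. A"]) auto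
  then have "sets (natural_filtration M W t) \<subseteq> sigma_sets (space M) \<C>"
    unfolding sets_natural_filtration by (intro sigma_sets_mono') auto
  moreover have "\<D> \<subseteq> sigma_sets (space M) \<D>"
    by auto
  ultimately show ?thesis
    using indep unfolding indep_sets2_eq \<D>_def[symmetric] by blast
qed

lemma distr_scaled_increment:
  assumes "0 \<le> s" "s < t"
  shows "distr M borel (\<lambda>\<omega>. (W t \<omega> - W s \<omega>) / sqrt (t - s)) = std_normal_distribution"
proof -
  have "distributed M lborel (\<lambda>\<omega>. (W t \<omega> - W s \<omega> - 0) / sqrt (t - s)) std_normal_density"
    using normal_increments[OF assms] assms by (subst normal_standard_normal_convert[symmetric]) auto
  then show ?thesis
    by (simp add: distributed_def cong: distr_cong)
qed

text \<open>The Gaussian law is given for increments, so \<open>W t\<close> is replaced by W t - W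
  0, which agrees with it almost surely and is sqrt t times a standard normal variable.\<close>

lemma integrable_exp_W:
  assumes "t > 0"
  shows "integrable M (\<lambda>\<omega>. exp (a * W t \<omega>))"
proof -
  let ?Z = "\<lambda>\<omega>. (W t \<omega> - W 0 \<omega>) / sqrt (t - 0)"
  have [measurable]: "random_variable borel (W t)" "random_variable borel (W 0)"
    using assms by (auto intro: measurable_W)
  have "integrable (distr M borel ?Z) (\<lambda>z. exp (a * sqrt t * z))"
    unfolding distr_scaled_increment[OF order.refl assms] by (rule integrable_normal_exp)
  then have "integrable M (\<lambda>\<omega>. exp (a * sqrt t * ?Z \<omega>))"
    by (subst (asm) integrable_distr_eq) auto
  then show ?thesis
    by (rule integrable_cong_AE_imp) (use start_zero assms in auto)
qed

end

section \<open>The conditional value of the call\<close>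

theorem proposition3:
  fixes M :: "'a measure" and W S :: "real \<Rightarrow> 'a \<Rightarrow> real"
    and r \<sigma> T K \<tau> D\<^sub>\<tau> A\<^sub>\<tau> B\<^sub>\<tau> V \<kappa> :: real
  assumes "r > 0" and "\<sigma> > 0" and "T > 0" and "K > 0"
    and "D\<^sub>\<tau> \<ge> 0" and "A\<^sub>\<tau> \<ge> 0" and "B\<^sub>\<tau> \<ge> 0"
    and "V = A\<^sub>\<tau> * exp (- B\<^sub>\<tau> * \<tau>)"
    and "\<kappa> = D\<^sub>\<tau> * \<tau>"
    and "standard_brownian_motion M W"
    and "\<And>t \<omega>. t \<ge> 0 \<Longrightarrow> \<omega> \<in> space M \<Longrightarrow>
      S t \<omega> = exp ((r - D\<^sub>\<tau> * \<tau> - 1 / 2 * V\<^sup>2 * \<sigma>\<^sup>2) * t + V * \<sigma> * W t \<omega>)"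
  shows "\<forall>t\<in>{0..T}. AE \<omega> in M.
    (let d\<^sub>1 = ereal (ln (S t \<omega> / K) + (r - \<kappa> + \<sigma>\<^sup>2 / 2 * V\<^sup>2) * (T - t)) /
              ereal (\<sigma> * V * sqrt (T - t));
         d\<^sub>2 = d\<^sub>1 - ereal (\<sigma> * V * sqrt (T - t))
     in risk_neutral_value M (natural_filtration M W) r T (\<lambda>\<omega>'. max 0 (S T \<omega>' - K)) t \<omega> =
        exp (- \<kappa> * (T - t)) * S t \<omega> * std_normal_cdf d\<^sub>1
        - K * exp (- r * (T - t)) * std_normal_cdf d\<^sub>2)"
proof
  fix t assume "t \<in> {0..T}"
  then have t: "0 \<le> t" "t \<le> T" by auto
  interpret standard_brownian_motion M W by fact
  define F where "F = natural_filtration M W t"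
  have F: "subalgebra M F"
    unfolding F_def by (rule subalgebra_natural_filtration)
  interpret finite_measure_subalgebra M F
    by unfold_locales (rule F)
  have space_F: "space F = space M"
    by (simp add: F_def)
  \<comment> \<open>\<open>a\<close> is the effective volatility and \<open>b\<close> the drift of
    the log price, so that S s = exp(b s + a W s).\<close>
  define a where "a = \<sigma> * V"
  define b where "b = r - \<kappa> - a\<^sup>2 / 2"
  have "V \<ge> 0"
    using assms by simp
  then have a: "a \<ge> 0"
    using \<open>\<sigma> > 0\<close> by (simp add: a_def)
  have S: "S s \<omega> = exp (b * s + a * W s \<omega>)" if "s \<ge> 0" "\<omega> \<in> space M" for s \<omega>
    using that assms by (simp add: a_def b_def power_mult_distrib mult_ac)
  have S_T: "S T \<omega> = S t \<omega> * exp (b * (T - t) + a * (W T \<omega> - W t \<omega>))" if "\<omega> \<in> space M" for \<omega>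
    using that t by (simp add: S algebra_simps flip: exp_add)
  have [measurable]: "W T \<in> borel_measurable M" "W t \<in> borel_measurable M"
    using t by (auto intro: measurable_W)
  have W_F[measurable]: "W t \<in> borel_measurable F"
    unfolding F_def using t by (intro measurable_natural_filtration) auto
  have S_F[measurable]: "S t \<in> borel_measurable F"
    by (subst measurable_cong[where g = "\<lambda>\<omega>. exp (b * t + a * W t \<omega>)"])
      (use t in \<open>auto simp: S space_F\<close>)
  have S_T_M[measurable]: "S T \<in> borel_measurable M"
    by (subst measurable_cong[where g = "\<lambda>\<omega>. exp (b * T + a * W T \<omega>)"])
      (use t in \<open>auto simp: S\<close>)
  \<comment> \<open>As K > 0, the payoff is dominated by \<open>S T\<close> itself, which has an
    exponential moment bound.\<close>
  have payoff: "integrable M (\<lambda>\<omega>. max 0 (S T \<omega> - K))"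
  proof (rule Bochner_Integration.integrable_bound)
    show "integrable M (\<lambda>\<omega>. exp (b * T) * exp (a * W T \<omega>))"
      using \<open>T > 0\<close> by (intro integrable_mult_right integrable_exp_W)
    show "AE \<omega> in M. norm (max 0 (S T \<omega> - K)) \<le> norm (exp (b * T) * exp (a * W T \<omega>))"
      using t \<open>K > 0\<close> by (intro AE_I2) (auto simp: S exp_add max_def)
  qed measurable
  \<comment> \<open>The shift \<open>p\<close> covers both terms: 0 gives \<open>d\<^sub>1\<close>
    and the remaining volatility gives \<open>d\<^sub>2\<close>.\<close>
  let ?N = "\<lambda>\<omega> p. std_normal_cdf (ereal (ln (S t \<omega> / K) + (r - \<kappa> + \<sigma>\<^sup>2 / 2 * V\<^sup>2) * (T - t)) /
              ereal (\<sigma> * V * sqrt (T - t)) - p)"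
  have "AE \<omega> in M. exp (- r * (T - t)) * real_cond_exp M F (\<lambda>\<omega>'. max 0 (S T \<omega>' - K)) \<omega> =
        exp (- \<kappa> * (T - t)) * S t \<omega> * ?N \<omega> 0
        - K * exp (- r * (T - t)) * ?N \<omega> (ereal (\<sigma> * V * sqrt (T - t)))"
  \<comment> \<open>The denominator of \<open>d\<^sub>1\<close> vanishes exactly at maturity or for
    zero volatility. Then \<open>S T\<close> is a deterministic multiple of \<open>S t\<close>, so
    the payoff is known at time \<open>t\<close>.\<close>
  proof (cases "a * sqrt (T - t) = 0")
    case True
    then have zero: "\<sigma> * V * sqrt (T - t) = 0" and var: "a\<^sup>2 * (T - t) = 0"
      by (auto simp: a_def)
    have S_T': "S T \<omega> = S t \<omega> * exp ((r - \<kappa>) * (T - t))" if "\<omega> \<in> space M" for \<omega>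
      using True S_T[OF that] by (auto simp: b_def)
    have "(\<lambda>\<omega>. max 0 (S T \<omega> - K)) \<in> borel_measurable F"
      by (subst measurable_cong[where g = "\<lambda>\<omega>. max 0 (S t \<omega> * exp ((r - \<kappa>) * (T - t)) - K)"])
        (auto simp: S_T' space_F)
    from real_cond_exp_F_meas[OF payoff this]
    show ?thesis
    proof (rule AE_mp, intro AE_I2 impI)
      fix \<omega> assume \<omega>: "\<omega> \<in> space M"
        and eq: "real_cond_exp M F (\<lambda>\<omega>. max 0 (S T \<omega> - K)) \<omega> = max 0 (S T \<omega> - K)"
      have pos: "S t \<omega> > 0"
        using \<omega> t by (simp add: S)
      define l where "l = ln (S t \<omega> / K) + (r - \<kappa> + \<sigma>\<^sup>2 / 2 * V\<^sup>2) * (T - t)"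
      have "l = ln (S T \<omega> / K) + a\<^sup>2 * (T - t) / 2"
        using pos \<open>K > 0\<close> by (simp add: l_def S_T' \<omega> ln_mult ln_div a_def power_mult_distrib algebra_simps)
      then have l: "l = ln (S T \<omega> / K)"
        using var by simp
      have disc: "exp (- r * (T - t)) * S T \<omega> = exp (- \<kappa> * (T - t)) * S t \<omega>"
        by (simp add: S_T' \<omega> algebra_simps flip: exp_add)
      have "S T \<omega> > 0"
        using \<omega> t by (simp add: S)
      \<comment> \<open>Here \<open>d\<^sub>1\<close> and \<open>d\<^sub>2\<close> are both l / 0 in
        the extended reals. The common factor is 1 for l > 0 (exercise) and 0 for l < 0; for l = 0
        both sides vanish because S T = K.\<close>
      then consider "S T \<omega> > K" "l > 0" | "S T \<omega> = K" "l = 0" | "S T \<omega> < K" "l < 0"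
        using \<open>K > 0\<close> unfolding l by (cases "S T \<omega>" K rule: linorder_cases) auto
      then have "exp (- r * (T - t)) * max 0 (S T \<omega> - K)
          = (exp (- r * (T - t)) * S T \<omega> - K * exp (- r * (T - t))) * std_normal_cdf (ereal l / ereal 0)"
        by cases (auto simp: algebra_simps divide_ereal_def simp flip: zero_ereal_def)
      then show "exp (- r * (T - t)) * real_cond_exp M F (\<lambda>\<omega>'. max 0 (S T \<omega>' - K)) \<omega> =
        exp (- \<kappa> * (T - t)) * S t \<omega> * ?N \<omega> 0
        - K * exp (- r * (T - t)) * ?N \<omega> (ereal (\<sigma> * V * sqrt (T - t)))"
        unfolding eq zero l_def[symmetric] disc
        by (simp add: algebra_simps flip: zero_ereal_def)
    qed
  next
    case False
    define v where "v = a * sqrt (T - t)"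
    have v: "v > 0" and lt: "t < T"
      using False a t by (auto simp: v_def intro: le_neq_trans)
    have v2: "v\<^sup>2 = a\<^sup>2 * (T - t)"
      using lt by (simp add: v_def power_mult_distrib)
    let ?Y = "\<lambda>\<omega>. W T \<omega> - W t \<omega>"
    \<comment> \<open>The sample point enters only through \<open>S t\<close>, which is
      \<open>F\<close>-measurable; \<open>y\<close> stands for the independent increment.\<close>
    let ?g = "\<lambda>\<omega> y. max 0 (S t \<omega> * exp (b * (T - t) + a * y) - K)"
    \<comment> \<open>The formula for \<open>S\<close> is given on the space of \<open>M\<close>
      only, so the two payoffs are compared almost everywhere.\<close>
    have g: "AE \<omega> in M. max 0 (S T \<omega> - K) = ?g \<omega> (?Y \<omega>)"
      by (intro AE_I2) (simp add: S_T)
    have [measurable]: "S t \<in> borel_measurable M"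
      by (rule measurable_from_subalg[OF F S_F])
    have "integrable M (\<lambda>\<omega>. ?g \<omega> (?Y \<omega>))"
      by (rule integrable_cong_AE_imp[OF payoff _ g]) measurable
    then have freeze: "AE \<omega> in M. real_cond_exp M F (\<lambda>\<omega>. ?g \<omega> (?Y \<omega>)) \<omega> = expectation (\<lambda>\<omega>'. ?g \<omega> (?Y \<omega>'))"
      by (intro real_cond_exp_freeze[where L = borel] F)
        (use indep_past_increment[OF t(1) lt] in \<open>simp_all add: F_def[symmetric]\<close>)
    have payoff_eq: "AE \<omega> in M. real_cond_exp M F (\<lambda>\<omega>. max 0 (S T \<omega> - K)) \<omega>
        = real_cond_exp M F (\<lambda>\<omega>. ?g \<omega> (?Y \<omega>)) \<omega>"
      by (rule real_cond_exp_cong[OF g]) measurable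
    have price: "exp (- r * (T - t)) * expectation (\<lambda>\<omega>'. ?g \<omega> (?Y \<omega>')) =
        exp (- \<kappa> * (T - t)) * S t \<omega> * ?N \<omega> 0
        - K * exp (- r * (T - t)) * ?N \<omega> (ereal (\<sigma> * V * sqrt (T - t)))" if \<omega>: "\<omega> \<in> space M" for \<omega>
    proof -
      have pos: "S t \<omega> > 0"
        using \<omega> t by (simp add: S)
      \<comment> \<open>This is \<open>d\<^sub>2\<close>; correspondingly d + v is
        \<open>d\<^sub>1\<close>.\<close>
      define d where "d = (ln (S t \<omega> / K) + b * (T - t)) / v"
      \<comment> \<open>Normalising the increment by sqrt(T - t) gives a standard normal variable
        and moves the scale into \<open>v\<close>.\<close>
      have "expectation (\<lambda>\<omega>'. ?g \<omega> (?Y \<omega>'))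
          = (\<integral>z. max 0 (S t \<omega> * exp (b * (T - t) + v * z) - K) \<partial>distr M borel (\<lambda>\<omega>'. ?Y \<omega>' / sqrt (T - t)))"
        using lt by (subst integral_distr) (auto simp: v_def)
      also have "\<dots> = S t \<omega> * exp (b * (T - t) + v\<^sup>2 / 2) * cdf std_normal_distribution (d + v)
          - K * cdf std_normal_distribution d"
        unfolding distr_scaled_increment[OF t(1) lt] d_def
        by (rule black_scholes_integral) (use pos \<open>K > 0\<close> v in auto)
      \<comment> \<open>The term -a^2/2 in the drift cancels the v^2/2 from completing the square;
        discounting the remaining rate r - \<kappa> leaves exp(-\<kappa>(T - t)).\<close>
      also have "b * (T - t) + v\<^sup>2 / 2 = (r - \<kappa>) * (T - t)"
        by (simp add: v2 b_def algebra_simps)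
      finally have E: "expectation (\<lambda>\<omega>'. ?g \<omega> (?Y \<omega>')) = S t \<omega> * exp ((r - \<kappa>) * (T - t))
          * cdf std_normal_distribution (d + v) - K * cdf std_normal_distribution d" .
      have disc: "exp (- r * (T - t)) * exp ((r - \<kappa>) * (T - t)) = exp (- \<kappa> * (T - t))"
        by (simp add: algebra_simps flip: exp_add)
      have vol: "\<sigma> * V * sqrt (T - t) = v"
        by (simp add: v_def a_def)
      \<comment> \<open>The numerator of \<open>d\<^sub>1\<close> has +a^2/2 where \<open>b\<close>
        has -a^2/2; the gap a^2 (T - t) is v^2, and division by \<open>v\<close> turns it into the
        shift from \<open>d\<close> to d + v.\<close>
      have "ln (S t \<omega> / K) + (r - \<kappa> + \<sigma>\<^sup>2 / 2 * V\<^sup>2) * (T - t)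
          = ln (S t \<omega> / K) + b * (T - t) + v * v"
        using v2 by (simp add: b_def a_def power_mult_distrib algebra_simps power2_eq_square[of v])
      also have "\<dots> = (d + v) * v"
        using v by (simp add: d_def field_simps)
      finally have "ereal (ln (S t \<omega> / K) + (r - \<kappa> + \<sigma>\<^sup>2 / 2 * V\<^sup>2) * (T - t)) /
          ereal (\<sigma> * V * sqrt (T - t)) = ereal (d + v)"
        unfolding vol using v by simp
      then show ?thesis
        unfolding E vol disc[symmetric] by (simp add: algebra_simps)
    qed
    show ?thesis
      using freeze payoff_eq AE_space
    proof eventually_elim
      case (elim \<omega>)
      show ?case
        by (simp only: elim(1,2) price[OF elim(3)])
    qed
  qed
  then show "AE \<omega> in M.
    (let d\<^sub>1 = ereal (ln (S t \<omega> / K) + (r - \<kappa> + \<sigma>\<^sup>2 / 2 * V\<^sup>2) * (T - t)) /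
              ereal (\<sigma> * V * sqrt (T - t));
         d\<^sub>2 = d\<^sub>1 - ereal (\<sigma> * V * sqrt (T - t))
     in risk_neutral_value M (natural_filtration M W) r T (\<lambda>\<omega>'. max 0 (S T \<omega>' - K)) t \<omega> =
        exp (- \<kappa> * (T - t)) * S t \<omega> * std_normal_cdf d\<^sub>1
        - K * exp (- r * (T - t)) * std_normal_cdf d\<^sub>2)"
    by (simp add: Let_def risk_neutral_value_def F_def)
qed

end
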